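(* For each $n\ge 3$ let $X=X^{(n)}=(X_{ij})$ be an $n\times n$ real symmetric random matrix whose off-diagonal entries $\{X_{ij}:1\le i<j\le n\}$ are independent standard Gaussian random variables, and let $L=L_X=(L_{ij})$ be its Laplacian matrix. Let $$a_n=\sqrt{2\log n}\qquad\text{and}\qquad b_n=\sqrt{2\log n}-\frac{\log\log n+\log 4\pi}{2\sqrt{2\log n}} .$$ Then $$M_n=a_n\left(\frac{\max_{1\le i\le n}L_{ii}}{\sqrt{n-1}}-\sqrt{\frac{n-2}{n-1}}\;b_n\right)$$ converges in distribution, as $n\to\infty$, to a Gumbel random variable.
   Context: For an $n\times n$ symmetric matrix $X=(X_{ij})$, the Laplacian matrix of $X$ is $L=L_X=D_X-X$, where $D_X$ is the diagonal matrix with $(D_X)_{ii}=\sum_{j=1}^n X_{ij}$. Thus $L_{ij}=-X_{ij}$ for $i\ne j$ and $L_{ii}=\sum_{j\neq i}X_{ij}$ (the diagonal of $X$ plays no role). A Gumbel random variable is one with distribution function $G(x)=\exp(-e^{-x})$, $x\in\mathbb{R}$. *)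

theory Defs
  imports "HOL-Probability.Probability" "Jordan_Normal_Form.Matrix"
begin

text \<open>
  Matrix indices run over \<open>0, \<dots>, n - 1\<close>. The name \<open>mat\<close> is qualified because
  HOL-Analysis has a constant of the same name for matrices of fixed type dimension.
\<close>

definition row_sum_mat :: "real mat \<Rightarrow> real mat" where
  "row_sum_mat X = Matrix.mat (dim_row X) (dim_row X)
     (\<lambda>(i, j). if i = j then (\<Sum>k<dim_col X. X $$ (i, k)) else 0)"

definition laplacian_mat :: "real mat \<Rightarrow> real mat" where
  "laplacian_mat X = row_sum_mat X - X"

lemma laplacian_mat_diag:
  assumes "X \<in> carrier_mat n n" "i < n"
  shows "laplacian_mat X $$ (i, i) = (\<Sum>j\<in>{..<n} - {i}. X $$ (i, j))"
  using assms by (auto simp: laplacian_mat_def row_sum_mat_def sum_diff1)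

lemma laplacian_mat_off_diag:
  assumes "X \<in> carrier_mat n n" "i < n" "j < n" "i \<noteq> j"
  shows "laplacian_mat X $$ (i, j) = - (X $$ (i, j))"
  using assms by (auto simp: laplacian_mat_def row_sum_mat_def)

definition gumbel_cdf :: "real \<Rightarrow> real" where
  "gumbel_cdf x = exp (- exp (- x))"

definition gumbel_distribution :: "real measure" where
  "gumbel_distribution = interval_measure gumbel_cdf"

lemma gumbel_cdf_props:
  shows "x \<le> y \<Longrightarrow> gumbel_cdf x \<le> gumbel_cdf y"
    and "continuous (at_right a) gumbel_cdf"
    and "(gumbel_cdf \<longlongrightarrow> 0) at_bot"
    and "(gumbel_cdf \<longlongrightarrow> 1) at_top"
proof -
  show "x \<le> y \<Longrightarrow> gumbel_cdf x \<le> gumbel_cdf y"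
    by (simp add: gumbel_cdf_def)
  show "continuous (at_right a) gumbel_cdf"
    unfolding gumbel_cdf_def by (intro continuous_intros)
  show "(gumbel_cdf \<longlongrightarrow> 0) at_bot"
    unfolding gumbel_cdf_def
    by (intro filterlim_compose[OF exp_at_bot]
        filterlim_compose[OF filterlim_uminus_at_bot_at_top]
        filterlim_compose[OF exp_at_top] filterlim_uminus_at_top_at_bot)
  have "((\<lambda>x::real. exp (- exp (- x))) \<longlongrightarrow> exp (- 0)) at_top"
    by (intro tendsto_intros filterlim_compose[OF exp_at_bot]
        filterlim_uminus_at_bot_at_top)
  then show "(gumbel_cdf \<longlongrightarrow> 1) at_top"
    by (simp add: gumbel_cdf_def[abs_def])
qed

lemma real_distribution_gumbel: "real_distribution gumbel_distribution"
  unfolding gumbel_distribution_def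
  by (rule real_distribution_interval_measure) (use gumbel_cdf_props in auto)

lemma cdf_gumbel: "cdf gumbel_distribution = gumbel_cdf"
  unfolding gumbel_distribution_def
  by (rule cdf_interval_measure) (use gumbel_cdf_props in auto)

definition a_seq :: "nat \<Rightarrow> real" where
  "a_seq n = sqrt (2 * ln (real n))"

definition b_seq :: "nat \<Rightarrow> real" where
  "b_seq n = sqrt (2 * ln (real n)) -
     (ln (ln (real n)) + ln (4 * pi)) / (2 * sqrt (2 * ln (real n)))"

definition normalized_max_diag :: "nat \<Rightarrow> real mat \<Rightarrow> real" where
  "normalized_max_diag n L =
     a_seq n * ((MAX i\<in>{..<n}. L $$ (i, i)) / sqrt (real n - 1) -
       sqrt ((real n - 2) / (real n - 1)) * b_seq n)"

end

theory Submission
  imports Defs "HOL-Real_Asymp.Real_Asymp"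
begin

text \<open>
  Let \<open>t\<close> be the threshold corresponding to \<open>M\<^sub>n \<le> x\<close>. By Brun's sieve it suffices that, for every
  fixed \<open>k\<close>, any \<open>k\<close> given diagonal entries all exceed \<open>t\<close> with probability asymptotic to
  \<open>(exp (- x) / n) ^ k\<close>, uniformly in the choice of the entries. Each of these entries is a sum over
  the other \<open>k - 1\<close> chosen columns plus a sum over the remaining \<open>n - k\<close> columns. The latter are
  independent \<open>N(0, n - k)\<close> variables, and the former are bounded by \<open>n\<close> to the power \<open>1/4\<close> outside an
  event of probability \<open>o(n ^ (- k))\<close>. A shift of \<open>t\<close> by this amount is negligible on the scale
  \<open>sqrt n / a\<^sub>n\<close> of the fluctuations, so the claim follows from the Mills ratio.
\<close>

section \<open>Asymptotics of the normalizing sequences and of the Gaussian density near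
  \<open>b_seq\<close>\<close>

lemma filterlim_a_seq: "filterlim a_seq at_top at_top"
  unfolding a_seq_def by real_asymp

lemma b_seq_asymp:
  shows "filterlim b_seq at_top at_top" "(\<lambda>n. b_seq n / a_seq n) \<longlonglongrightarrow> 1"
proof -
  \<comment> \<open>Both limits hold with any constant in place of \<open>ln (4 * pi)\<close>, so it
    is kept as a parameter.\<close>
  define c where "c = ln (4 * pi)"
  show "filterlim b_seq at_top at_top" "(\<lambda>n. b_seq n / a_seq n) \<longlonglongrightarrow> 1"
    unfolding a_seq_def b_seq_def c_def[symmetric] by real_asymp+
qed

text \<open>This explains the correction term in \<open>b_seq\<close>. With \<open>L = ln n\<close>
  and \<open>c = ln L + ln (4 * pi)\<close>, the cross term in the square of \<open>b_seq n\<close>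
  is exactly \<open>- c\<close>. Hence the exponential contributes \<open>1 / n\<close> times
  \<open>exp (c / 2) = sqrt (2 * L) * sqrt (2 * pi)\<close>; the second root cancels the constant of
  the density and the first is \<open>a_seq n\<close>. The remaining exponential comes from the
  square of the correction and tends to 1.\<close>

lemma std_normal_density_b_seq:
  assumes "n \<ge> 3"
  shows "real n * std_normal_density (b_seq n) =
    a_seq n * exp (- (ln (ln (real n)) + ln (4 * pi))\<^sup>2 / (16 * ln (real n)))"
proof -
  define L where "L = ln (real n)"
  define c where "c = ln L + ln (4 * pi)"
  have L: "L > 0" using assms by (simp add: L_def)
  have "(b_seq n)\<^sup>2 = (sqrt (2 * L))\<^sup>2 - c + (c / (2 * sqrt (2 * L)))\<^sup>2"
    unfolding b_seq_def L_def[symmetric] c_def[symmetric] power2_diff using L by simp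
  also have "\<dots> = 2 * L - c + c\<^sup>2 / (8 * L)"
    using L by (simp add: power_divide power_mult_distrib)
  finally have "- (b_seq n)\<^sup>2 / 2 = - L + c / 2 + (- c\<^sup>2 / (16 * L))"
    by simp
  then have "exp (- (b_seq n)\<^sup>2 / 2) = exp (- L) * exp (c / 2) * exp (- c\<^sup>2 / (16 * L))"
    by (simp only: exp_add)
  moreover have "exp (c / 2) = sqrt (4 * pi * L)"
  proof -
    have "c = ln (4 * pi * L)" using L by (simp add: c_def ln_mult)
    then show ?thesis using L by (simp add: ln_sqrt[symmetric])
  qed
  moreover have "exp (- L) = 1 / real n" using assms by (simp add: L_def exp_minus inverse_eq_divide)
  moreover have "sqrt (4 * pi * L) = sqrt (2 * L) * sqrt (2 * pi)"
    by (simp add: real_sqrt_mult[symmetric] mult_ac)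
  ultimately show ?thesis using assms
    unfolding std_normal_density_def c_def[symmetric] L_def[symmetric] a_seq_def by simp
qed

text \<open>As density over argument approximates the Gaussian tail, this says that
  \<open>b_seq n\<close> is the level which one of \<open>n\<close> standard normals exceeds on
  average.\<close>

lemma tendsto_std_normal_density_b_seq:
  "(\<lambda>n. real n * std_normal_density (b_seq n) / b_seq n) \<longlonglongrightarrow> 1"
proof -
  define c where "c = ln (4 * pi)"
  have "(\<lambda>n::nat. exp (- (ln (ln (real n)) + c)\<^sup>2 / (16 * ln (real n)))) \<longlonglongrightarrow> 1"
    by real_asymp
  from tendsto_mult[OF this tendsto_inverse[OF b_seq_asymp(2)]]
  have "(\<lambda>n. a_seq n * exp (- (ln (ln (real n)) + c)\<^sup>2 / (16 * ln (real n))) / b_seq n) \<longlonglongrightarrow> 1"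
    by (simp add: field_simps)
  then show ?thesis
    by (rule Lim_transform_eventually)
      (use std_normal_density_b_seq in \<open>auto simp: c_def eventually_sequentially intro!: exI[of _ 3]\<close>)
qed

text \<open>Write \<open>v = b_seq + y / a_seq\<close> with \<open>y\<close> tending to
  \<open>x\<close>. In half the square of \<open>v\<close> the cross term is
  \<open>(b_seq / a_seq) * y\<close>, which tends to \<open>x\<close> and produces the Gumbel factor
  \<open>exp (- x)\<close>; the square of \<open>y / a_seq\<close> vanishes. Divergence of
  \<open>v\<close> is recorded because it makes the Mills ratio sharp.\<close>

lemma tendsto_std_normal_density_near_b_seq:
  assumes "(\<lambda>n. a_seq n * (v n - b_seq n)) \<longlonglongrightarrow> x"
  shows "(\<lambda>n. real n * std_normal_density (v n) / v n) \<longlonglongrightarrow> exp (- x)"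
    and "filterlim v at_top at_top"
proof -
  define y where "y n = a_seq n * (v n - b_seq n)" for n
  have y: "y \<longlonglongrightarrow> x" using assms by (simp add: y_def[abs_def])
  have a_pos: "\<forall>\<^sub>F n in sequentially. a_seq n > 0" and b_pos: "\<forall>\<^sub>F n in sequentially. b_seq n > 0"
    using filterlim_a_seq b_seq_asymp(1) by (auto simp: filterlim_at_top_dense)
  have inv_a: "(\<lambda>n. 1 / a_seq n) \<longlonglongrightarrow> 0" and inv_b: "(\<lambda>n. 1 / b_seq n) \<longlonglongrightarrow> 0"
    using filterlim_a_seq b_seq_asymp(1)
    by (auto intro!: tendsto_divide_0 filterlim_at_top_imp_at_infinity)
  have v: "\<forall>\<^sub>F n in sequentially. v n = b_seq n + y n * (1 / a_seq n)"
    using a_pos by eventually_elim (simp add: y_def)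
  have "filterlim (\<lambda>n. b_seq n + y n * (1 / a_seq n)) at_top at_top"
    using filterlim_tendsto_add_at_top[OF tendsto_mult[OF y inv_a] b_seq_asymp(1)]
    by (simp add: add.commute)
  then show "filterlim v at_top at_top"
    using filterlim_cong[OF refl refl v] by blast
  have "(\<lambda>n. 1 + y n * (1 / a_seq n) * (1 / b_seq n)) \<longlonglongrightarrow> 1 + x * 0 * 0"
    by (intro tendsto_intros y inv_a inv_b)
  then have ratio: "(\<lambda>n. inverse (1 + y n * (1 / a_seq n) * (1 / b_seq n))) \<longlonglongrightarrow> 1"
    using tendsto_inverse[of _ 1] by simp
  have ex: "(\<lambda>n. exp (- (b_seq n / a_seq n * y n + (y n * (1 / a_seq n))\<^sup>2 / 2))) \<longlonglongrightarrow> exp (- (1 * x + (x * 0)\<^sup>2 / 2))"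
    by (intro tendsto_intros y inv_a b_seq_asymp) simp
  \<comment> \<open>The three factors are the value at \<open>b_seq n\<close>, the quotient
    \<open>b_seq n / v n\<close>, and the quotient of the densities at \<open>v n\<close> and
    \<open>b_seq n\<close>.\<close>
  have "(\<lambda>n. real n * std_normal_density (b_seq n) / b_seq n *
      inverse (1 + y n * (1 / a_seq n) * (1 / b_seq n)) *
      exp (- (b_seq n / a_seq n * y n + (y n * (1 / a_seq n))\<^sup>2 / 2))) \<longlonglongrightarrow> exp (- x)"
    using tendsto_mult[OF tendsto_mult[OF tendsto_std_normal_density_b_seq ratio] ex] by simp
  moreover have "\<forall>\<^sub>F n in sequentially. real n * std_normal_density (b_seq n) / b_seq n *
      inverse (1 + y n * (1 / a_seq n) * (1 / b_seq n)) *
      exp (- (b_seq n / a_seq n * y n + (y n * (1 / a_seq n))\<^sup>2 / 2)) =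
      real n * std_normal_density (v n) / v n"
    using a_pos b_pos v
  proof eventually_elim
    case (elim n)
    have "std_normal_density (v n) = std_normal_density (b_seq n) *
        exp (- (b_seq n / a_seq n * y n + (y n * (1 / a_seq n))\<^sup>2 / 2))"
      unfolding normal_density_def elim(3)
    proof -
      have "- (b_seq n + y n * (1 / a_seq n))\<^sup>2 / 2 = - (b_seq n)\<^sup>2 / 2 +
          - (b_seq n / a_seq n * y n + (y n * (1 / a_seq n))\<^sup>2 / 2)"
        by (simp add: power2_sum add_divide_distrib diff_divide_distrib)
      then show "1 / sqrt (2 * pi * 1\<^sup>2) * exp (- (b_seq n + y n * (1 / a_seq n) - 0)\<^sup>2 / (2 * 1\<^sup>2)) =
        1 / sqrt (2 * pi * 1\<^sup>2) * exp (- (b_seq n - 0)\<^sup>2 / (2 * 1\<^sup>2)) *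
        exp (- (b_seq n / a_seq n * y n + (y n * (1 / a_seq n))\<^sup>2 / 2))"
        by (simp only: diff_0_right power_one mult_1_right exp_add mult.assoc)
    qed
    moreover have "v n = b_seq n * (1 + y n * (1 / a_seq n) * (1 / b_seq n))"
      using elim by (simp add: distrib_left)
    ultimately show ?case
      by (simp only: divide_inverse inverse_mult_distrib mult.assoc mult.commute mult.left_commute)
  qed
  ultimately show "(\<lambda>n. real n * std_normal_density (v n) / v n) \<longlonglongrightarrow> exp (- x)"
    by (rule Lim_transform_eventually)
qed

text \<open>The numerator is the row sum threshold shifted by
  \<open>\<delta> * n powr (1/4)\<close>; the denominator is the standard deviation of a sum of
  \<open>n - k\<close> entries. Exchanging \<open>n - 1\<close> and \<open>n - 2\<close> for
  \<open>n - k\<close> costs a relative error of order \<open>1 / n\<close>, and the shift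
  contributes \<open>a_seq n\<close> times a term of order \<open>n powr (-1/4)\<close>. Both
  vanish, so the limit depends on neither \<open>\<delta>\<close> nor \<open>k\<close>.\<close>

lemma tendsto_perturbed_threshold:
  fixes x \<delta> k :: real
  shows "(\<lambda>n. a_seq n * ((sqrt (real n - 1) * x / a_seq n + sqrt (real n - 2) * b_seq n +
    \<delta> * real n powr (1/4)) / sqrt (real n - k) - b_seq n)) \<longlonglongrightarrow> x"
proof -
  define c where "c = ln (4 * pi)"
  show ?thesis
    unfolding a_seq_def b_seq_def c_def[symmetric] by real_asymp
qed

section \<open>Gaussian tails and the Mills ratio\<close>

definition normal_tail :: "real \<Rightarrow> real" where
  "normal_tail v = measure std_normal_distribution {v<..}"

lemma (in prob_space) prob_greater_std_normal:
  assumes "distributed M lborel Z std_normal_density"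
  shows "prob {\<omega> \<in> space M. Z \<omega> > v} = normal_tail v"
proof -
  have "normal_tail v = measure (distr M lborel Z) {v<..}"
    by (simp only: normal_tail_def distributed_distr_eq_density[OF assms])
  also have "\<dots> = prob (Z -` {v<..} \<inter> space M)"
    using distributed_measurable[OF assms] by (intro measure_distr) auto
  also have "Z -` {v<..} \<inter> space M = {\<omega> \<in> space M. Z \<omega> > v}" by auto
  finally show ?thesis ..
qed

lemma normal_tail_nonneg: "normal_tail v \<ge> 0"
  by (simp add: normal_tail_def)

text \<open>The derivative of the density is \<open>- x\<close> times the density, so minus density
  over \<open>x\<close> is an antiderivative of the density times \<open>1 + 1 / x^2\<close>. Thus
  \<open>std_normal_density v / v\<close> is the integral of this product beyond \<open>v\<close>,
  where the extra factor lies between 1 and \<open>1 + 1 / v^2\<close>.\<close>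

lemma mills_ratio:
  assumes "v > 0"
  shows "normal_tail v \<le> std_normal_density v / v"
    and "std_normal_density v / v \<le> (1 + 1 / v\<^sup>2) * normal_tail v"
proof -
  interpret real_distribution std_normal_distribution by (rule real_dist_normal_dist)
  let ?f = "\<lambda>x::real. std_normal_density x * (1 + 1 / x\<^sup>2)"
  have "(\<integral>\<^sup>+x. ennreal (?f x) * indicator {v..} x \<partial>lborel) = 0 - (- std_normal_density v / v)"
  proof (rule nn_integral_FTC_atLeast)
    show "((\<lambda>x. - std_normal_density x / x) \<longlongrightarrow> 0) at_top"
      unfolding std_normal_density_def by real_asymp
    show "((\<lambda>x. - std_normal_density x / x) has_real_derivative ?f x) (at x)" if "v \<le> x" for x
    proof -
      define c where "c = 1 / sqrt (2 * pi)"
      have "std_normal_density = (\<lambda>x. c * exp (- x\<^sup>2 / 2))"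
        by (simp add: fun_eq_iff std_normal_density_def c_def)
      then have "(std_normal_density has_real_derivative - x * std_normal_density x) (at x)"
        by (auto intro!: derivative_eq_intros)
      then show ?thesis using that assms
        by (auto intro!: derivative_eq_intros simp: field_simps power2_eq_square)
    qed
  qed (auto intro!: mult_nonneg_nonneg)
  moreover have "(\<integral>\<^sup>+x. ennreal (?f x) * indicator {v..} x \<partial>lborel) =
      (\<integral>\<^sup>+x. ennreal (?f x) * indicator {v<..} x \<partial>lborel)"
    by (rule nn_integral_cong_AE)
      (use AE_lborel_singleton[of v] in eventually_elim, auto simp: indicator_def)
  ultimately have eq: "(\<integral>\<^sup>+x. ennreal (?f x) * indicator {v<..} x \<partial>lborel) =
      ennreal (std_normal_density v / v)"
    by simp
  have tail: "ennreal (normal_tail v) = (\<integral>\<^sup>+x. ennreal (std_normal_density x) * indicator {v<..} x \<partial>lborel)"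
    unfolding normal_tail_def emeasure_eq_measure[symmetric] by (simp add: emeasure_density)
  have "ennreal (normal_tail v) \<le> ennreal (std_normal_density v / v)"
    unfolding tail eq[symmetric]
    by (intro nn_integral_mono mult_right_mono ennreal_leI) (auto simp: algebra_simps)
  then show "normal_tail v \<le> std_normal_density v / v"
    using assms by simp
  have "ennreal (std_normal_density v / v) \<le>
      (\<integral>\<^sup>+x. ennreal (1 + 1 / v\<^sup>2) * (ennreal (std_normal_density x) * indicator {v<..} x) \<partial>lborel)"
    unfolding eq[symmetric]
  proof (rule nn_integral_mono)
    fix x :: real
    show "ennreal (?f x) * indicator {v<..} x \<le>
      ennreal (1 + 1 / v\<^sup>2) * (ennreal (std_normal_density x) * indicator {v<..} x)"
    proof (cases "x > v")
      case True
      then have "1 / x\<^sup>2 \<le> 1 / v\<^sup>2" using assms by (intro divide_left_mono power_mono) auto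
      then have "?f x \<le> std_normal_density x * (1 + 1 / v\<^sup>2)"
        by (intro mult_left_mono) auto
      then have "?f x \<le> (1 + 1 / v\<^sup>2) * std_normal_density x"
        by (simp only: mult.commute)
      then have "ennreal (?f x) \<le> ennreal ((1 + 1 / v\<^sup>2) * std_normal_density x)"
        by (rule ennreal_leI)
      also have "\<dots> = ennreal (1 + 1 / v\<^sup>2) * ennreal (std_normal_density x)"
        by (rule ennreal_mult) auto
      finally show ?thesis using True by simp
    qed simp
  qed
  also have "\<dots> = ennreal ((1 + 1 / v\<^sup>2) * normal_tail v)"
    by (subst nn_integral_cmult) (auto simp: tail[symmetric] ennreal_mult normal_tail_nonneg)
  finally show "std_normal_density v / v \<le> (1 + 1 / v\<^sup>2) * normal_tail v"
    by (subst (asm) ennreal_le_iff) (auto simp: normal_tail_nonneg)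
qed

text \<open>The two Mills bounds differ by the factor \<open>1 + 1 / (v n)^2\<close>, which tends to
  1 because \<open>v\<close> diverges.\<close>

lemma tendsto_normal_tail_near_b_seq:
  assumes "(\<lambda>n. a_seq n * (v n - b_seq n)) \<longlonglongrightarrow> x"
  shows "(\<lambda>n. real n * normal_tail (v n)) \<longlonglongrightarrow> exp (- x)"
proof (rule tendsto_sandwich)
  note lims = tendsto_std_normal_density_near_b_seq[OF assms]
  have v_pos: "\<forall>\<^sub>F n in sequentially. v n > 0"
    using lims(2) by (auto simp: filterlim_at_top_dense)
  show "\<forall>\<^sub>F n in sequentially. real n * normal_tail (v n) \<le> real n * std_normal_density (v n) / v n"
    using v_pos by eventually_elim (simp add: mills_ratio(1) mult_left_mono flip: times_divide_eq_right)
  show "\<forall>\<^sub>F n in sequentially. real n * std_normal_density (v n) / v n * inverse (1 + 1 / (v n)\<^sup>2) \<le> real n * normal_tail (v n)"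
    using v_pos
  proof eventually_elim
    case (elim n)
    have "std_normal_density (v n) / v n * inverse (1 + 1 / (v n)\<^sup>2) \<le> normal_tail (v n)"
    proof -
      have "1 + 1 / (v n)\<^sup>2 > 0" by (simp add: add_pos_nonneg)
      then show ?thesis using mills_ratio(2)[OF elim]
        by (simp only: divide_inverse[symmetric] pos_divide_le_eq mult.commute)
    qed
    then have "real n * (std_normal_density (v n) / v n * inverse (1 + 1 / (v n)\<^sup>2)) \<le> real n * normal_tail (v n)"
      by (rule mult_left_mono) simp
    then show ?case by (simp only: times_divide_eq_right times_divide_eq_left mult.assoc)
  qed
  show "(\<lambda>n. real n * std_normal_density (v n) / v n) \<longlonglongrightarrow> exp (- x)" by fact
  have "(\<lambda>n. 1 / (v n)\<^sup>2) \<longlonglongrightarrow> 0"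
    by (intro tendsto_divide_0[OF tendsto_const] filterlim_at_top_imp_at_infinity filterlim_pow_at_top lims) simp
  then have "(\<lambda>n. inverse (1 + 1 / (v n)\<^sup>2)) \<longlonglongrightarrow> inverse (1 + 0)"
    by (intro tendsto_intros) simp_all
  from tendsto_mult[OF lims(1) this]
  show "(\<lambda>n. real n * std_normal_density (v n) / v n * inverse (1 + 1 / (v n)\<^sup>2)) \<longlonglongrightarrow> exp (- x)"
    by simp
qed

text \<open>At level \<open>n powr (1/4)\<close> the tail decays exponentially in a multiple of
  \<open>sqrt n\<close>, faster than any power of \<open>n\<close>. This keeps the entries shared
  between chosen rows negligible even after summing over all \<open>k\<close>-subsets.\<close>

lemma tendsto_power_normal_tail_powr:
  "(\<lambda>n. real n ^ k * normal_tail (real n powr (1/4) / (real k + 1))) \<longlonglongrightarrow> 0"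
proof (rule tendsto_sandwich[OF _ _ tendsto_const])
  show "(\<lambda>n. real n ^ k * (std_normal_density (real n powr (1/4) / (real k + 1)) /
      (real n powr (1/4) / (real k + 1)))) \<longlonglongrightarrow> 0"
    unfolding std_normal_density_def by real_asymp
  show "\<forall>\<^sub>F n in sequentially. real n ^ k * normal_tail (real n powr (1/4) / (real k + 1)) \<le>
     real n ^ k * (std_normal_density (real n powr (1/4) / (real k + 1)) /
      (real n powr (1/4) / (real k + 1)))"
    using eventually_gt_at_top[of 0]
    by eventually_elim (intro mult_left_mono mills_ratio, auto)
qed (simp add: normal_tail_nonneg)

section \<open>Bonferroni inequalities and Brun's sieve\<close>

text \<open>Pascal's rule telescopes the sum. The point is the sign \<open>(-1) ^ m\<close>, which
  makes truncated inclusion-exclusion one-sided.\<close>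

lemma alternating_binomial_sum:
  "(\<Sum>k\<le>m. (-1) ^ k * real (Suc N choose k)) = (-1) ^ m * real (N choose m)"
  by (induction m) (simp_all add: algebra_simps)

text \<open>The inequality holds pointwise before integration: if \<open>N\<close> of the events
  occur, the integrand of \<open>S k\<close> is \<open>N choose k\<close>. The truncated alternating
  sum equals 1 for \<open>N = 0\<close> and has sign \<open>(-1) ^ m\<close> otherwise. The factor
  \<open>(-1) ^ m\<close> states the upper bound (even \<open>m\<close>) and the lower bound (odd
  \<open>m\<close>) at once.\<close>

lemma (in prob_space) bonferroni:
  fixes A :: "'i \<Rightarrow> 'a set"
  assumes I: "finite I" and A: "\<And>i. i \<in> I \<Longrightarrow> A i \<in> events"
  defines "S \<equiv> \<lambda>k. \<Sum>K | K \<subseteq> I \<and> card K = k. prob (space M \<inter> (\<Inter>i\<in>K. A i))"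
  shows "0 \<le> (-1) ^ m * ((\<Sum>k\<le>m. (-1) ^ k * S k) - prob (space M - (\<Union>i\<in>I. A i)))"
proof -
  define N where "N \<omega> = card {i \<in> I. \<omega> \<in> A i}" for \<omega>
  \<comment> \<open>An empty intersection is \<open>UNIV\<close>; meeting it with
    \<open>space M\<close> makes the term for \<open>K = {}\<close> the sure event, so
    \<open>S 0 = 1\<close>.\<close>
  have ev: "space M \<inter> (\<Inter>i\<in>K. A i) \<in> events" if "K \<subseteq> I" for K
  proof (cases "K = {}")
    case False
    then show ?thesis using that A finite_subset[OF that I]
      by (intro sets.Int sets.top sets.finite_INT) auto
  qed simp
  have ev': "space M - (\<Union>i\<in>I. A i) \<in> events" using A I by auto
  have count: "(\<Sum>K | K \<subseteq> I \<and> card K = k. indicator (space M \<inter> (\<Inter>i\<in>K. A i)) \<omega>) = real (N \<omega> choose k)"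
    if "\<omega> \<in> space M" for k \<omega>
  proof -
    have "(\<Sum>K | K \<subseteq> I \<and> card K = k. indicator (space M \<inter> (\<Inter>i\<in>K. A i)) \<omega>) =
        (\<Sum>K | K \<subseteq> I \<and> card K = k. if K \<subseteq> {i \<in> I. \<omega> \<in> A i} then 1 else (0::real))"
      using that by (intro sum.cong) (auto simp: indicator_def)
    also have "\<dots> = real (card {K. K \<subseteq> {i \<in> I. \<omega> \<in> A i} \<and> card K = k})"
      using I by (subst sum.inter_filter[symmetric]) (auto intro!: arg_cong[where f=card])
    also have "\<dots> = real (N \<omega> choose k)"
      unfolding N_def by (subst n_subsets) (use I in auto)
    finally show ?thesis .
  qed
  let ?g = "\<lambda>\<omega>. (-1) ^ m * ((\<Sum>k\<le>m. (-1) ^ k * (\<Sum>K | K \<subseteq> I \<and> card K = k.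
      indicator (space M \<inter> (\<Inter>i\<in>K. A i)) \<omega>)) - indicator (space M - (\<Union>i\<in>I. A i)) \<omega>) :: real"
  have "0 \<le> expectation ?g"
  proof (rule integral_nonneg_AE, rule AE_I2)
    fix \<omega> assume \<omega>: "\<omega> \<in> space M"
    have g: "?g \<omega> = (-1) ^ m * ((\<Sum>k\<le>m. (-1) ^ k * real (N \<omega> choose k)) - indicator (space M - (\<Union>i\<in>I. A i)) \<omega>)"
      by (simp only: count[OF \<omega>])
    show "0 \<le> ?g \<omega>"
    proof (cases "N \<omega>")
      case 0
      then have "\<omega> \<notin> (\<Union>i\<in>I. A i)" using I by (auto simp: N_def)
      moreover have "(\<Sum>k\<le>m. (-1) ^ k * real (0 choose k)) = 1" by (induction m) auto
      ultimately show ?thesis unfolding g 0 using \<omega> by simp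
    next
      case (Suc N')
      then have "{i \<in> I. \<omega> \<in> A i} \<noteq> {}" unfolding N_def by fastforce
      then have "indicator (space M - (\<Union>i\<in>I. A i)) \<omega> = (0::real)" by (auto simp: indicator_def)
      \<comment> \<open>The sign of the truncated sum cancels against \<open>(-1) ^ m\<close> and
        leaves \<open>N' choose m\<close>.\<close>
      then show ?thesis unfolding g Suc alternating_binomial_sum
        by (simp add: power_mult_distrib[symmetric] mult.assoc[symmetric])
    qed
  qed
  also have "expectation ?g = (-1) ^ m * ((\<Sum>k\<le>m. (-1) ^ k * S k) - prob (space M - (\<Union>i\<in>I. A i)))"
  proof -
    have int: "integrable M (indicator B :: _ \<Rightarrow> real)" if "B \<in> events" for B
      using that by (simp add: emeasure_eq_measure)
    have S: "expectation (\<lambda>\<omega>. \<Sum>K | K \<subseteq> I \<and> card K = k. indicator (space M \<inter> (\<Inter>i\<in>K. A i)) \<omega>) = S k" for k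
      unfolding S_def using ev by (subst Bochner_Integration.integral_sum) (auto intro!: int)
    have intS: "integrable M (\<lambda>\<omega>. \<Sum>K | K \<subseteq> I \<and> card K = k. indicator (space M \<inter> (\<Inter>i\<in>K. A i)) \<omega> :: real)" for k
      by (intro Bochner_Integration.integrable_sum int ev) auto
    show ?thesis
      by (simp only: integral_mult_right_zero)
        (subst Bochner_Integration.integral_diff;
          (intro Bochner_Integration.integrable_sum integrable_mult_right intS int ev')?;
          subst Bochner_Integration.integral_sum;
          (intro integrable_mult_right intS)?;
          simp add: S ev' sets.sets_into_space Int_absorb2)
  qed
  finally show ?thesis .
qed

text \<open>For fixed \<open>m\<close> let \<open>n\<close> grow in the Bonferroni inequalities, so
  the bounds tend to the partial sums \<open>T m\<close> of the exponential series; then choose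
  \<open>m\<close> large.\<close>

lemma tendsto_prob_no_event:
  fixes M :: "nat \<Rightarrow> 'w measure" and A :: "nat \<Rightarrow> 'i \<Rightarrow> 'w set"
  assumes M: "\<forall>\<^sub>F n in sequentially. prob_space (M n) \<and> finite (I n) \<and> (\<forall>i\<in>I n. A n i \<in> sets (M n))"
    and S: "\<And>k. (\<lambda>n. \<Sum>K | K \<subseteq> I n \<and> card K = k. measure (M n) (space (M n) \<inter> (\<Inter>i\<in>K. A n i)))
      \<longlonglongrightarrow> \<mu> ^ k / fact k"
  shows "(\<lambda>n. measure (M n) (space (M n) - (\<Union>i\<in>I n. A n i))) \<longlonglongrightarrow> exp (- \<mu>)"
proof -
  define S where "S n k = (\<Sum>K | K \<subseteq> I n \<and> card K = k. measure (M n) (space (M n) \<inter> (\<Inter>i\<in>K. A n i)))" for n k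
  define p where "p n = measure (M n) (space (M n) - (\<Union>i\<in>I n. A n i))" for n
  define T where "T m = (\<Sum>k\<le>m. (-1) ^ k * (\<mu> ^ k / fact k))" for m
  have bonf: "\<forall>\<^sub>F n in sequentially. 0 \<le> (-1) ^ m * ((\<Sum>k\<le>m. (-1) ^ k * S n k) - p n)" for m
    using M by eventually_elim (auto simp: S_def p_def intro!: prob_space.bonferroni)
  have lim: "(\<lambda>n. \<Sum>k\<le>m. (-1) ^ k * S n k) \<longlonglongrightarrow> T m" for m
    unfolding T_def S_def by (intro tendsto_intros S)
  have T: "T \<longlonglongrightarrow> exp (- \<mu>)"
  proof -
    have "(\<lambda>k. (- \<mu>) ^ k /\<^sub>R fact k) sums exp (- \<mu>)" by (rule exp_converges)
    moreover have "(- \<mu>) ^ k /\<^sub>R fact k = (-1) ^ k * (\<mu> ^ k / fact k)" for k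
      by (simp add: power_minus[of \<mu>] field_simps)
    ultimately show ?thesis by (simp add: sums_def_le T_def[abs_def])
  qed
  have "p \<longlonglongrightarrow> exp (- \<mu>)"
  proof (rule order_tendstoI)
    fix a assume "a < exp (- \<mu>)"
    then obtain m0 where "\<And>m. m \<ge> m0 \<Longrightarrow> a < T m"
      using order_tendstoD(1)[OF T] by (auto simp: eventually_sequentially)
    \<comment> \<open>An odd index is taken because the truncated sum is then a lower bound for
      \<open>p n\<close>.\<close>
    then have "a < T (2 * m0 + 1)" by simp
    from order_tendstoD(1)[OF lim this] bonf[of "2 * m0 + 1"]
    show "\<forall>\<^sub>F n in sequentially. a < p n" by eventually_elim simp
  next
    fix a assume "exp (- \<mu>) < a"
    then obtain m0 where "\<And>m. m \<ge> m0 \<Longrightarrow> T m < a"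
      using order_tendstoD(2)[OF T] by (auto simp: eventually_sequentially)
    \<comment> \<open>At an even index the truncated sum is an upper bound for
      \<open>p n\<close>.\<close>
    then have "T (2 * m0) < a" by simp
    from order_tendstoD(2)[OF lim this] bonf[of "2 * m0"]
    show "\<forall>\<^sub>F n in sequentially. p n < a" by eventually_elim simp
  qed
  then show ?thesis by (simp add: p_def[abs_def])
qed


section \<open>Joint exceedance probabilities of several row sums\<close>

lemma (in prob_space) prob_abs_greater_std_normal_le:
  assumes Z: "distributed M lborel Z std_normal_density"
  shows "prob {\<omega> \<in> space M. \<bar>Z \<omega>\<bar> > c} \<le> 2 * normal_tail c"
proof -
  have neg: "distributed M lborel (\<lambda>\<omega>. - Z \<omega>) std_normal_density"
    using normal_density_affine[OF Z, of "-1" 0] by simp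
  have [measurable]: "Z \<in> borel_measurable M" using distributed_measurable[OF Z] by simp
  have "{\<omega> \<in> space M. \<bar>Z \<omega>\<bar> > c} \<subseteq> {\<omega> \<in> space M. Z \<omega> > c} \<union> {\<omega> \<in> space M. - Z \<omega> > c}"
    by auto
  then have "prob {\<omega> \<in> space M. \<bar>Z \<omega>\<bar> > c} \<le>
      prob ({\<omega> \<in> space M. Z \<omega> > c} \<union> {\<omega> \<in> space M. - Z \<omega> > c})"
    by (rule finite_measure_mono) measurable
  also have "\<dots> \<le> prob {\<omega> \<in> space M. Z \<omega> > c} + prob {\<omega> \<in> space M. - Z \<omega> > c}"
    by (rule measure_Un_le) measurable
  also have "\<dots> = 2 * normal_tail c"
    using prob_greater_std_normal[OF Z] prob_greater_std_normal[OF neg] by simp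
  finally show ?thesis .
qed

text \<open>Sums over disjoint blocks of an independent family are independent, and each block of
  size \<open>m\<close> has a centred normal sum with variance \<open>m\<close>, so the probability
  factorizes.\<close>

lemma (in prob_space) prob_block_sums_greater:
  fixes Y :: "'e \<Rightarrow> 'a \<Rightarrow> real" and m :: nat
  assumes indep: "indep_vars (\<lambda>_. borel) Y E"
    and gauss: "\<And>e. e \<in> E \<Longrightarrow> distributed M lborel (Y e) std_normal_density"
    and L: "finite L" and J: "\<And>i. i \<in> L \<Longrightarrow> J i \<subseteq> E" "\<And>i. i \<in> L \<Longrightarrow> card (J i) = m" "m > 0"
    and disj: "disjoint_family_on J L"
  shows "prob {\<omega> \<in> space M. \<forall>i\<in>L. (\<Sum>e\<in>J i. Y e \<omega>) > u} = normal_tail (u / sqrt m) ^ card L"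
proof (cases "L = {}")
  case True
  then show ?thesis by (simp add: prob_space)
next
  case False
  define S where "S i \<omega> = (\<Sum>e\<in>J i. Y e \<omega>)" for i \<omega>
  have "indep_vars (\<lambda>_. borel) (\<lambda>i \<omega>. \<Sum>e\<in>J i. restrict (\<lambda>e. Y e \<omega>) (J i) e) L"
    by (rule indep_vars_compose2[OF indep_vars_restrict[OF indep J(1) disj], where Y = "\<lambda>i f. \<Sum>e\<in>J i. f e"])
      auto
  then have indS: "indep_vars (\<lambda>_. borel) S L"
    unfolding S_def[abs_def] by simp
  have S: "prob (S i -` {u<..} \<inter> space M) = normal_tail (u / sqrt m)" if i: "i \<in> L" for i
  proof -
    have "finite (J i)" "J i \<noteq> {}" using J(2)[OF i] J(3) by (auto intro: card_ge_0_finite)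
    then have "distributed M lborel (S i) (normal_density (\<Sum>e\<in>J i. 0) (sqrt (\<Sum>e\<in>J i. 1\<^sup>2)))"
      unfolding S_def[abs_def]
      by (intro sum_indep_normal indep_vars_subset[OF indep J(1)[OF i]] gauss) (use J(1)[OF i] in auto)
    then have "distributed M lborel (S i) (normal_density 0 (sqrt m))"
      using J(2)[OF i] by simp
    then have "distributed M lborel (\<lambda>\<omega>. (S i \<omega> - 0) / sqrt m) std_normal_density"
      using J(3) by (subst normal_standard_normal_convert[symmetric]) auto
    from prob_greater_std_normal[OF this, of "u / sqrt m"]
    have "prob {\<omega> \<in> space M. u / sqrt m < S i \<omega> / sqrt m} = normal_tail (u / sqrt m)" by simp
    moreover have "{\<omega> \<in> space M. u / sqrt m < S i \<omega> / sqrt m} = S i -` {u<..} \<inter> space M"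
      using J(3) by (auto simp: divide_less_cancel)
    ultimately show ?thesis by simp
  qed
  have "{\<omega> \<in> space M. \<forall>i\<in>L. S i \<omega> > u} = (\<Inter>i\<in>L. S i -` {u<..} \<inter> space M)"
    using False by auto
  also have "prob \<dots> = (\<Prod>i\<in>L. prob (S i -` {u<..} \<inter> space M))"
    by (rule indep_varsD_finite[OF indS]) (use L False in auto)
  also have "\<dots> = normal_tail (u / sqrt m) ^ card L"
    using S by simp
  finally show ?thesis unfolding S_def .
qed

text \<open>
  A row sum over \<open>i \<in> K\<close> splits into the at most \<open>card K - 1\<close> entries with column in \<open>K\<close>, which
  are shared between rows but small, and the remaining entries, which are disjoint for distinct rows.
\<close>

lemma (in prob_space) prob_row_sums_greater:
  fixes Y :: "nat \<times> nat \<Rightarrow> 'a \<Rightarrow> real" and t :: real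
  assumes indep: "indep_vars (\<lambda>_. borel) Y {(i, j). i < j \<and> j < n}"
    and gauss: "\<And>i j. i < j \<Longrightarrow> j < n \<Longrightarrow> distributed M lborel (Y (i, j)) std_normal_density"
    and K: "K \<subseteq> {..<n}" "card K = k" "k < n" and s: "s \<ge> 0"
  defines "P \<equiv> prob {\<omega> \<in> space M. \<forall>i\<in>K. (\<Sum>j\<in>{..<n} - {i}. Y (min i j, max i j) \<omega>) > t}"
  shows "normal_tail ((t + s) / sqrt (real n - real k)) ^ k - 2 * (real k)\<^sup>2 * normal_tail (s / (real k + 1)) \<le> P"
    and "P \<le> normal_tail ((t - s) / sqrt (real n - real k)) ^ k + 2 * (real k)\<^sup>2 * normal_tail (s / (real k + 1))"
proof -
  define Z where "Z i j = Y (min i j, max i j)" for i j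
  define R where "R i \<omega> = (\<Sum>j\<in>{..<n} - {i}. Z i j \<omega>)" for i \<omega>
  define H where "H i \<omega> = (\<Sum>j\<in>K - {i}. Z i j \<omega>)" for i \<omega>
  define G where "G i \<omega> = (\<Sum>j\<in>{..<n} - K. Z i j \<omega>)" for i \<omega>
  define D where "D = {(i, j) \<in> K \<times> K. i \<noteq> j}"
  \<comment> \<open>Outside \<open>B\<close> every shared entry is at most
    \<open>s / (real k + 1)\<close> in absolute value. The divisor exceeds the number of terms of
    \<open>H i\<close> for \<open>i\<close> in \<open>K\<close> and is positive for every
    \<open>k\<close>, so \<open>H i\<close> is then bounded by \<open>s\<close>.\<close>
  define B where "B = (\<Union>(i, j)\<in>D. {\<omega> \<in> space M. \<bar>Z i j \<omega>\<bar> > s / (real k + 1)})"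
  have finK: "finite K" using K(1) finite_subset by blast
  have Z: "distributed M lborel (Z i j) std_normal_density" if "i < n" "j < n" "i \<noteq> j" for i j
    unfolding Z_def using that by (intro gauss) (auto simp: min_def max_def)
  have Zm: "Z i j \<in> borel_measurable M" if "i < n" "j < n" "i \<noteq> j" for i j
    using distributed_measurable[OF Z[OF that]] by simp
  have Rm: "R i \<in> borel_measurable M" and Gm: "G i \<in> borel_measurable M" if "i \<in> K" for i
    unfolding R_def[abs_def] G_def[abs_def] using K(1) that
    by (auto intro!: borel_measurable_sum Zm)
  have Re: "{\<omega> \<in> space M. \<forall>i\<in>K. R i \<omega> > u} \<in> events" and Ge: "{\<omega> \<in> space M. \<forall>i\<in>K. G i \<omega> > u} \<in> events" for u
    using finK Rm Gm by (auto intro!: sets.sets_Collect_finite_All')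
  have finD: "finite D" unfolding D_def using finK by (auto intro: finite_subset[of _ "K \<times> K"])
  have Dn: "i < n" "j < n" "i \<noteq> j" if "(i, j) \<in> D" for i j
    using that K(1) by (auto simp: D_def)
  have Be': "{\<omega> \<in> space M. \<bar>Z i j \<omega>\<bar> > c} \<in> events" if "(i, j) \<in> D" for i j c
    using Zm[OF Dn[OF that]] by measurable
  have Be: "B \<in> events"
    unfolding B_def using finD Be' by (intro sets.finite_UN) auto
  have PB: "prob B \<le> 2 * (real k)\<^sup>2 * normal_tail (s / (real k + 1))"
  proof -
    have "prob B \<le> (\<Sum>d\<in>D. prob (case d of (i, j) \<Rightarrow> {\<omega> \<in> space M. \<bar>Z i j \<omega>\<bar> > s / (real k + 1)}))"
      unfolding B_def using finD Be' by (intro finite_measure_subadditive_finite) auto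
    also have "\<dots> \<le> (\<Sum>d\<in>D. 2 * normal_tail (s / (real k + 1)))"
      by (intro sum_mono) (auto dest: Dn intro!: prob_abs_greater_std_normal_le Z)
    also have "\<dots> = real (card D) * (2 * normal_tail (s / (real k + 1)))" by simp
    also have "\<dots> \<le> real (card (K \<times> K)) * (2 * normal_tail (s / (real k + 1)))"
      using finK by (intro mult_right_mono of_nat_mono card_mono) (auto simp: D_def normal_tail_nonneg)
    also have "\<dots> = 2 * (real k)\<^sup>2 * normal_tail (s / (real k + 1))"
      using K(2) by (simp add: card_cartesian_product power2_eq_square)
    finally show ?thesis .
  qed
  have H: "\<bar>H i \<omega>\<bar> \<le> s" if "i \<in> K" "\<omega> \<in> space M" "\<omega> \<notin> B" for i \<omega>
  proof -
    have "\<bar>H i \<omega>\<bar> \<le> (\<Sum>j\<in>K - {i}. \<bar>Z i j \<omega>\<bar>)" unfolding H_def by (rule sum_abs)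
    also have "\<dots> \<le> (\<Sum>j\<in>K - {i}. s / (real k + 1))"
      using that by (intro sum_mono) (force simp: B_def D_def)
    also have "\<dots> = real (card (K - {i})) * (s / (real k + 1))" by simp
    also have "\<dots> \<le> (real k + 1) * (s / (real k + 1))"
      using K(2) card_Diff1_le[of K i] s by (intro mult_right_mono) auto
    also have "\<dots> = s" by simp
    finally show ?thesis .
  qed
  have R: "R i \<omega> = H i \<omega> + G i \<omega>" if "i \<in> K" for i \<omega>
  proof -
    have eq: "{..<n} - {i} = (K - {i}) \<union> ({..<n} - K)" using K(1) that by auto
    show ?thesis unfolding R_def H_def G_def eq
      by (rule sum.union_disjoint) (use finK in auto)
  qed
  have G: "prob {\<omega> \<in> space M. \<forall>i\<in>K. G i \<omega> > u} = normal_tail (u / sqrt (real n - real k)) ^ k" for u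
  proof -
    \<comment> \<open>\<open>J i\<close> collects the positions above the diagonal that
      \<open>G i\<close> reads. Each unordered pair in it has exactly one member in
      \<open>K\<close>, namely \<open>i\<close>, so the blocks of distinct rows in \<open>K\<close>
      are disjoint.\<close>
    define J where "J i = (\<lambda>j. (min i j, max i j)) ` ({..<n} - K)" for i
    have inj: "inj_on (\<lambda>j. (min i j, max i j)) A" for i :: nat and A
      by (auto simp: inj_on_def min_def max_def split: if_splits)
    have "card (J i) = n - k" for i
      unfolding J_def by (subst card_image[OF inj]) (use K finK in \<open>auto simp: card_Diff_subset\<close>)
    moreover have "J i \<subseteq> {(i, j). i < j \<and> j < n}" if "i \<in> K" for i
      using that K(1) unfolding J_def by (auto simp: min_def max_def le_less)
    moreover have "disjoint_family_on J K"
      unfolding disjoint_family_on_def J_def by (auto simp: min_def max_def split: if_splits)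
    moreover have "G i \<omega> = (\<Sum>e\<in>J i. Y e \<omega>)" for i \<omega>
      unfolding J_def G_def Z_def by (subst sum.reindex[OF inj]) simp
    ultimately show ?thesis
      using prob_block_sums_greater[OF indep _ finK, of J "n - k" u] K gauss
      by (auto simp: of_nat_diff)
  qed
  have RG: "\<bar>R i \<omega> - G i \<omega>\<bar> \<le> s" if "i \<in> K" "\<omega> \<in> space M" "\<omega> \<notin> B" for i \<omega>
    using H[OF that] R[OF that(1)] by simp
  \<comment> \<open>Outside \<open>B\<close> the sums \<open>R i\<close> and \<open>G i\<close>
    differ by at most \<open>s\<close>, so exceedance by one family implies exceedance by the other
    at a level lower by \<open>s\<close>. This gives both bounds.\<close>
  have "{\<omega> \<in> space M. \<forall>i\<in>K. G i \<omega> > t + s} \<subseteq> {\<omega> \<in> space M. \<forall>i\<in>K. R i \<omega> > t} \<union> B"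
  proof
    fix \<omega> assume \<omega>: "\<omega> \<in> {\<omega> \<in> space M. \<forall>i\<in>K. G i \<omega> > t + s}"
    have "R i \<omega> > t" if "i \<in> K" "\<omega> \<notin> B" for i
    proof -
      have "G i \<omega> > t + s" "\<omega> \<in> space M" using \<omega> that(1) by auto
      then show ?thesis using RG[of i \<omega>] that by linarith
    qed
    then show "\<omega> \<in> {\<omega> \<in> space M. \<forall>i\<in>K. R i \<omega> > t} \<union> B" using \<omega> by auto
  qed
  then have "prob {\<omega> \<in> space M. \<forall>i\<in>K. G i \<omega> > t + s} \<le> prob ({\<omega> \<in> space M. \<forall>i\<in>K. R i \<omega> > t} \<union> B)"
    by (rule finite_measure_mono) (intro sets.Un Re Be)
  also have "\<dots> \<le> prob {\<omega> \<in> space M. \<forall>i\<in>K. R i \<omega> > t} + prob B"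
    by (intro measure_Un_le Re Be)
  finally show "normal_tail ((t + s) / sqrt (real n - real k)) ^ k - 2 * (real k)\<^sup>2 * normal_tail (s / (real k + 1)) \<le> P"
    using PB unfolding G P_def R_def Z_def by simp
  have "{\<omega> \<in> space M. \<forall>i\<in>K. R i \<omega> > t} \<subseteq> {\<omega> \<in> space M. \<forall>i\<in>K. G i \<omega> > t - s} \<union> B"
  proof
    fix \<omega> assume \<omega>: "\<omega> \<in> {\<omega> \<in> space M. \<forall>i\<in>K. R i \<omega> > t}"
    have "G i \<omega> > t - s" if "i \<in> K" "\<omega> \<notin> B" for i
    proof -
      have "R i \<omega> > t" "\<omega> \<in> space M" using \<omega> that(1) by auto
      then show ?thesis using RG[of i \<omega>] that by linarith
    qed
    then show "\<omega> \<in> {\<omega> \<in> space M. \<forall>i\<in>K. G i \<omega> > t - s} \<union> B" using \<omega> by auto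
  qed
  then have "prob {\<omega> \<in> space M. \<forall>i\<in>K. R i \<omega> > t} \<le> prob ({\<omega> \<in> space M. \<forall>i\<in>K. G i \<omega> > t - s} \<union> B)"
    by (rule finite_measure_mono) (intro sets.Un Ge Be)
  also have "\<dots> \<le> prob {\<omega> \<in> space M. \<forall>i\<in>K. G i \<omega> > t - s} + prob B"
    by (intro measure_Un_le Ge Be)
  finally show "P \<le> normal_tail ((t - s) / sqrt (real n - real k)) ^ k + 2 * (real k)\<^sup>2 * normal_tail (s / (real k + 1))"
    using PB unfolding G P_def R_def Z_def by simp
qed

section \<open>Counting subsets of rows and convergence of the normalized maximum\<close>

lemma tendsto_binomial_over_power:
  "(\<lambda>n. real (n choose k) / real n ^ k) \<longlonglongrightarrow> 1 / fact k"
proof -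
  have "(\<lambda>n::nat. (real n - real i) / real n) \<longlonglongrightarrow> 1" for i by real_asymp
  then have "(\<lambda>n. (\<Prod>i = 0..<k. (real n - real i) / real n) / fact k) \<longlonglongrightarrow> (\<Prod>i = 0..<k. 1) / fact k"
    by (intro tendsto_intros) auto
  moreover have "(\<Prod>i = 0..<k. (real n - real i) / real n) / fact k = real (n choose k) / real n ^ k" for n
    unfolding binomial_gbinomial gbinomial_prod_rev by (simp add: prod_dividef field_simps)
  ultimately show ?thesis by simp
qed

theorem proposition4:
  fixes M :: "nat \<Rightarrow> 'w measure"
    and X :: "nat \<Rightarrow> 'w \<Rightarrow> real mat"
  assumes prob: "\<And>n. n \<ge> 3 \<Longrightarrow> prob_space (M n)"
    and dim: "\<And>n \<omega>. n \<ge> 3 \<Longrightarrow> \<omega> \<in> space (M n) \<Longrightarrow> X n \<omega> \<in> carrier_mat n n"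
    and sym: "\<And>n \<omega>. n \<ge> 3 \<Longrightarrow> \<omega> \<in> space (M n) \<Longrightarrow> transpose_mat (X n \<omega>) = X n \<omega>"
    and meas: "\<And>n i j. n \<ge> 3 \<Longrightarrow> i < n \<Longrightarrow> j < n \<Longrightarrow>
      (\<lambda>\<omega>. X n \<omega> $$ (i, j)) \<in> borel_measurable (M n)"
    and gauss: "\<And>n i j. n \<ge> 3 \<Longrightarrow> i < j \<Longrightarrow> j < n \<Longrightarrow>
      distributed (M n) lborel (\<lambda>\<omega>. X n \<omega> $$ (i, j)) std_normal_density"
    and indep: "\<And>n. n \<ge> 3 \<Longrightarrow>
      prob_space.indep_vars (M n) (\<lambda>_. borel) (\<lambda>(i, j) \<omega>. X n \<omega> $$ (i, j))
        {(i, j). i < j \<and> j < n}"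
  shows "weak_conv_m
    (\<lambda>n. distr (M n) borel (\<lambda>\<omega>. normalized_max_diag n (laplacian_mat (X n \<omega>))))
    gumbel_distribution"
  unfolding weak_conv_m_def weak_conv_def cdf_gumbel
proof (intro allI impI)
  fix x :: real
  define R where "R n i \<omega> = (\<Sum>j\<in>{..<n} - {i}. X n \<omega> $$ (min i j, max i j))" for n i \<omega>
  \<comment> \<open>Solving \<open>normalized_max_diag n L \<le> x\<close> for the maximum gives
    \<open>t n\<close>; multiplication by \<open>sqrt (n - 1)\<close> turns
    \<open>sqrt ((n - 2) / (n - 1))\<close> into \<open>sqrt (n - 2)\<close>.\<close>
  define t where "t n = sqrt (real n - 1) * x / a_seq n + sqrt (real n - 2) * b_seq n" for n
  define A where "A n i = {\<omega> \<in> space (M n). R n i \<omega> > t n}" for n i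
  have diag: "laplacian_mat (X n \<omega>) $$ (i, i) = R n i \<omega>"
    if n: "n \<ge> 3" and \<omega>: "\<omega> \<in> space (M n)" and i: "i < n" for n \<omega> i
  proof -
    have "X n \<omega> $$ (i, j) = X n \<omega> $$ (min i j, max i j)" if "j < n" for j
    proof (cases "i \<le> j")
      case False
      have "X n \<omega> $$ (i, j) = transpose_mat (X n \<omega>) $$ (i, j)" using sym[OF n \<omega>] by simp
      also have "\<dots> = X n \<omega> $$ (j, i)" using dim[OF n \<omega>] i that by auto
      finally show ?thesis using False by (simp add: min_def max_def)
    qed (simp add: min_def max_def)
    then show ?thesis
      unfolding laplacian_mat_diag[OF dim[OF n \<omega>] i] R_def by (intro sum.cong) auto
  qed
  have Rm: "R n i \<in> borel_measurable (M n)" if "n \<ge> 3" "i < n" for n i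
    unfolding R_def[abs_def] using that by (intro borel_measurable_sum meas) auto
  have Ae: "A n i \<in> sets (M n)" if "n \<ge> 3" "i < n" for n i
    unfolding A_def using Rm[OF that] by measurable
  have cdf_eq: "cdf (distr (M n) borel (\<lambda>\<omega>. normalized_max_diag n (laplacian_mat (X n \<omega>)))) x =
      measure (M n) (space (M n) - (\<Union>i\<in>{..<n}. A n i))" if n: "n \<ge> 3" for n
  proof -
    define W where "W \<omega> = a_seq n * ((MAX i\<in>{..<n}. R n i \<omega>) / sqrt (real n - 1) -
       sqrt ((real n - 2) / (real n - 1)) * b_seq n)" for \<omega>
    have W: "normalized_max_diag n (laplacian_mat (X n \<omega>)) = W \<omega>" if "\<omega> \<in> space (M n)" for \<omega>
    proof -
      have "(\<lambda>i. laplacian_mat (X n \<omega>) $$ (i, i)) ` {..<n} = (\<lambda>i. R n i \<omega>) ` {..<n}"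
        using diag[OF n that] by (intro image_cong) auto
      then show ?thesis unfolding normalized_max_diag_def W_def by simp
    qed
    have "(\<lambda>\<omega>. MAX i\<in>{..<n}. R n i \<omega>) \<in> borel_measurable (M n)"
      using Rm[OF n] by (intro borel_measurable_Max) auto
    then have Wm: "W \<in> borel_measurable (M n)"
      unfolding W_def[abs_def] by measurable
    have Wx: "W \<omega> \<le> x \<longleftrightarrow> (\<forall>i<n. R n i \<omega> \<le> t n)" for \<omega>
    proof -
      have a: "a_seq n > 0" using n by (simp add: a_seq_def)
      have q: "sqrt (real n - 1) > 0" using n by simp
      have "W \<omega> \<le> x \<longleftrightarrow> (MAX i\<in>{..<n}. R n i \<omega>) / sqrt (real n - 1) \<le>
          x / a_seq n + sqrt ((real n - 2) / (real n - 1)) * b_seq n"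
        unfolding W_def using a by (simp add: field_simps)
      also have "\<dots> \<longleftrightarrow> (MAX i\<in>{..<n}. R n i \<omega>) \<le>
          (x / a_seq n + sqrt ((real n - 2) / (real n - 1)) * b_seq n) * sqrt (real n - 1)"
        using q by (simp only: pos_divide_le_eq)
      also have "(x / a_seq n + sqrt ((real n - 2) / (real n - 1)) * b_seq n) * sqrt (real n - 1) = t n"
        unfolding t_def real_sqrt_divide using q by (simp add: field_simps)
      also have "(MAX i\<in>{..<n}. R n i \<omega>) \<le> t n \<longleftrightarrow> (\<forall>i<n. R n i \<omega> \<le> t n)"
        using n by (subst Max_le_iff) (auto simp: lessThan_empty_iff)
      finally show ?thesis .
    qed
    have "distr (M n) borel (\<lambda>\<omega>. normalized_max_diag n (laplacian_mat (X n \<omega>))) = distr (M n) borel W"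
      using W by (intro distr_cong) auto
    then have "cdf (distr (M n) borel (\<lambda>\<omega>. normalized_max_diag n (laplacian_mat (X n \<omega>)))) x =
        measure (M n) (W -` {..x} \<inter> space (M n))"
      unfolding cdf_def by (simp add: measure_distr[OF Wm])
    also have "W -` {..x} \<inter> space (M n) = space (M n) - (\<Union>i\<in>{..<n}. A n i)"
      by (force simp: A_def Wx not_less)
    finally show ?thesis .
  qed
  \<comment> \<open>The sieve is applied with \<open>\<mu> = exp (- x)\<close>, the limiting mean
    number of exceedances; the Gumbel value is the Poisson probability of none.\<close>
  have "(\<lambda>n. measure (M n) (space (M n) - (\<Union>i\<in>{..<n}. A n i))) \<longlonglongrightarrow> exp (- exp (- x))"
  proof (rule tendsto_prob_no_event)
    show "\<forall>\<^sub>F n in sequentially. prob_space (M n) \<and> finite {..<n} \<and> (\<forall>i\<in>{..<n}. A n i \<in> sets (M n))"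
      using prob Ae by (auto simp: eventually_sequentially intro!: exI[of _ 3])
  next
    fix k
    \<comment> \<open>\<open>v 1\<close> and \<open>v (-1)\<close> are the standardized thresholds
      after moving \<open>t n\<close> up or down by \<open>s = n powr (1/4)\<close>, and
      \<open>err\<close> bounds the probability of the exceptional event for this
      \<open>s\<close>.\<close>
    define v where "v \<delta> n = (t n + \<delta> * real n powr (1/4)) / sqrt (real n - real k)" for \<delta> n
    define err where "err n = 2 * (real k)\<^sup>2 * normal_tail (real n powr (1/4) / (real k + 1))" for n
    let ?S = "\<lambda>n. \<Sum>K | K \<subseteq> {..<n} \<and> card K = k. measure (M n) (space (M n) \<inter> (\<Inter>i\<in>K. A n i))"
    have bounds: "normal_tail (v 1 n) ^ k - err n \<le> measure (M n) (space (M n) \<inter> (\<Inter>i\<in>K. A n i))"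
      "measure (M n) (space (M n) \<inter> (\<Inter>i\<in>K. A n i)) \<le> normal_tail (v (-1) n) ^ k + err n"
      if n: "n \<ge> 3" "n > k" and K: "K \<subseteq> {..<n}" "card K = k" for n K
    proof -
      interpret prob_space "M n" using prob n by simp
      have ind: "indep_vars (\<lambda>_. borel) (\<lambda>e \<omega>. X n \<omega> $$ e) {(i, j). i < j \<and> j < n}"
        using indep[OF n(1)] by (simp add: case_prod_unfold)
      have "space (M n) \<inter> (\<Inter>i\<in>K. A n i) = {\<omega> \<in> space (M n). \<forall>i\<in>K. R n i \<omega> > t n}"
        by (auto simp: A_def)
      then show "normal_tail (v 1 n) ^ k - err n \<le> measure (M n) (space (M n) \<inter> (\<Inter>i\<in>K. A n i))"
        "measure (M n) (space (M n) \<inter> (\<Inter>i\<in>K. A n i)) \<le> normal_tail (v (-1) n) ^ k + err n"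
        using prob_row_sums_greater[OF ind gauss[OF n(1)] K n(2), of "real n powr (1/4)" "t n"]
        by (simp_all add: R_def v_def err_def)
    qed
    have card: "card {K. K \<subseteq> {..<n} \<and> card K = k} = n choose k" for n
      using n_subsets[of "{..<n}" k] by simp
    \<comment> \<open>One limit serves both sides of the sandwich: \<open>\<delta> = 1\<close>,
      \<open>\<epsilon> = -1\<close> below and \<open>\<delta> = -1\<close>,
      \<open>\<epsilon> = 1\<close> above. The power \<open>n ^ k\<close> is moved from the binomial
      coefficient to the tails, where it yields the \<open>k\<close>-th power of
      \<open>n * normal_tail (v \<delta> n)\<close> and a vanishing error.\<close>
    have lim: "(\<lambda>n. real (n choose k) * (normal_tail (v \<delta> n) ^ k + \<epsilon> * err n)) \<longlonglongrightarrow> exp (- x) ^ k / fact k" for \<delta> \<epsilon>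
    proof -
      have "(\<lambda>n. real n * normal_tail (v \<delta> n)) \<longlonglongrightarrow> exp (- x)"
        unfolding v_def t_def by (intro tendsto_normal_tail_near_b_seq tendsto_perturbed_threshold)
      then have "(\<lambda>n. real (n choose k) / real n ^ k * ((real n * normal_tail (v \<delta> n)) ^ k +
          \<epsilon> * (2 * (real k)\<^sup>2) * (real n ^ k * normal_tail (real n powr (1/4) / (real k + 1))))) \<longlonglongrightarrow>
          1 / fact k * (exp (- x) ^ k + \<epsilon> * (2 * (real k)\<^sup>2) * 0)"
        by (intro tendsto_intros tendsto_binomial_over_power tendsto_power_normal_tail_powr)
      then have "(\<lambda>n. real (n choose k) / real n ^ k * ((real n * normal_tail (v \<delta> n)) ^ k +
          \<epsilon> * (2 * (real k)\<^sup>2) * (real n ^ k * normal_tail (real n powr (1/4) / (real k + 1))))) \<longlonglongrightarrow>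
          exp (- x) ^ k / fact k" by simp
      moreover have "\<forall>\<^sub>F n in sequentially. real (n choose k) / real n ^ k * ((real n * normal_tail (v \<delta> n)) ^ k +
          \<epsilon> * (2 * (real k)\<^sup>2) * (real n ^ k * normal_tail (real n powr (1/4) / (real k + 1)))) =
          real (n choose k) * (normal_tail (v \<delta> n) ^ k + \<epsilon> * err n)"
        using eventually_gt_at_top[of 0]
        by eventually_elim (simp add: err_def power_mult_distrib field_simps)
      ultimately show ?thesis by (rule Lim_transform_eventually)
    qed
    have ev: "\<forall>\<^sub>F n in sequentially. n \<ge> 3 \<and> n > k"
      using eventually_ge_at_top[of 3] eventually_gt_at_top[of k] by eventually_elim simp
    show "?S \<longlonglongrightarrow> exp (- x) ^ k / fact k"
    proof (rule tendsto_sandwich[OF _ _ lim[of 1 "-1"] lim[of "-1" 1]])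
      show "\<forall>\<^sub>F n in sequentially. real (n choose k) * (normal_tail (v 1 n) ^ k + - 1 * err n) \<le> ?S n"
        using ev
      proof eventually_elim
        case (elim n)
        have "real (card {K. K \<subseteq> {..<n} \<and> card K = k}) * (normal_tail (v 1 n) ^ k + - 1 * err n) \<le> ?S n"
          by (rule sum_bounded_below) (use bounds[of n] elim in auto)
        then show ?case by (simp only: card)
      qed
      show "\<forall>\<^sub>F n in sequentially. ?S n \<le> real (n choose k) * (normal_tail (v (- 1) n) ^ k + 1 * err n)"
        using ev
      proof eventually_elim
        case (elim n)
        have "?S n \<le> real (card {K. K \<subseteq> {..<n} \<and> card K = k}) * (normal_tail (v (- 1) n) ^ k + 1 * err n)"
          by (rule sum_bounded_above) (use bounds[of n] elim in auto)
        then show ?case by (simp only: card)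
      qed
    qed
  qed
  then have "(\<lambda>n. measure (M n) (space (M n) - (\<Union>i\<in>{..<n}. A n i))) \<longlonglongrightarrow> gumbel_cdf x"
    by (simp add: gumbel_cdf_def)
  then show "(\<lambda>n. cdf (distr (M n) borel (\<lambda>\<omega>. normalized_max_diag n (laplacian_mat (X n \<omega>)))) x) \<longlonglongrightarrow> gumbel_cdf x"
    by (rule Lim_transform_eventually)
      (use cdf_eq in \<open>auto simp: eventually_sequentially intro!: exI[of _ 3]\<close>)
qed

end
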